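(* Let $n$ be a positive integer. The number of partitions of $n$ into distinct odd parts is equal to the number of partitions of $n$ into distinct positive integers, each of which is odd or a multiple of $4$, such that any two consecutive parts differ by at least $4$ and any two parts that are both multiples of $4$ differ by at least $8$.
   Context: A partition of $n$ is written $\lambda_1+\cdots+\lambda_s$ with parts in non-increasing order; consecutive parts are $\lambda_i,\lambda_{i+1}$. *)

theory Defs
  imports Main
begin

text \<open>A partition of \<open>n\<close> is represented by the list of its parts in non-increasing order,
  so \<open>xs ! i\<close> and \<open>xs ! Suc i\<close> are consecutive parts.\<close>

definition is_partition :: "nat \<Rightarrow> nat list \<Rightarrow> bool" where
  "is_partition n xs \<longleftrightarrow> sorted_wrt (\<ge>) xs \<and> (\<forall>x\<in>set xs. 0 < x) \<and> sum_list xs = n"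

definition distinct_odd_partitions :: "nat \<Rightarrow> nat list set" where
  "distinct_odd_partitions n = {xs. is_partition n xs \<and> distinct xs \<and> (\<forall>x\<in>set xs. odd x)}"

text \<open>The parts are non-increasing, so ``differ by at least \<open>d\<close>'' is stated as
  \<open>later + d \<le> earlier\<close>, avoiding truncated subtraction. The last condition is about any two
  parts, not only consecutive ones.\<close>

definition gap_partitions :: "nat \<Rightarrow> nat list set" where
  "gap_partitions n = {xs. is_partition n xs \<and> distinct xs \<and>
     (\<forall>x\<in>set xs. odd x \<or> 4 dvd x) \<and>
     (\<forall>i. Suc i < length xs \<longrightarrow> xs ! Suc i + 4 \<le> xs ! i) \<and>
     (\<forall>i j. i < j \<and> j < length xs \<and> 4 dvd xs ! i \<and> 4 dvd xs ! j \<longrightarrow> xs ! j + 8 \<le> xs ! i)}"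

text \<open>Both sets are finite, so \<open>card\<close> is a genuine count.\<close>

lemma finite_partitions: "finite {xs. is_partition n xs}"
proof (rule finite_subset)
  have "length xs \<le> sum_list xs" if "\<forall>x\<in>set xs. 0 < x" for xs :: "nat list"
    using that by (induction xs) auto
  then show "{xs. is_partition n xs} \<subseteq> {xs. set xs \<subseteq> {..n} \<and> length xs \<le> n}"
    by (auto simp: is_partition_def member_le_sum_list)
  show "finite {xs. set xs \<subseteq> {..n} \<and> length xs \<le> n}"
    by (rule finite_lists_length_le) simp
qed

lemma finite_distinct_odd_partitions: "finite (distinct_odd_partitions n)"
  by (rule finite_subset[OF _ finite_partitions[of n]]) (auto simp: distinct_odd_partitions_def)

lemma finite_gap_partitions: "finite (gap_partitions n)"
  by (rule finite_subset[OF _ finite_partitions[of n]]) (auto simp: gap_partitions_def)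

end

theory Submission
  imports Defs "HOL-Library.FuncSet" "HOL-Computational_Algebra.Polynomial"
begin

text \<open>
  This is the case of modulus 4 and residues 1, 3 of Bressoud's generalization of Schur's partition
  theorem, proved here with generating polynomials in \<open>q\<close>.

  Let \<open>d\<^sub>m\<close> be the generating polynomial of the gap partitions with parts at most \<open>4m - 1\<close>.
  Removing the largest part successively for the bounds \<open>4m\<close>, \<open>4m + 1\<close> and \<open>4m + 3\<close>, and
  eliminating the polynomials for the bounds congruent to 0 and 1 modulo 4, gives with
  \<open>p = q\<^sup>4\<close>, \<open>a = q\<close> and \<open>b = q\<^sup>3\<close> (\<open>gap_gf_bressoud\<close>)
  \<open>d\<^bsub>m+2\<^esub> = (1 + (a + b) p^(m+1)) d\<^bsub>m+1\<^esub> + a b p^m (1 - p^(m+1)) d\<^sub>m\<close>.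
  Regard \<open>d\<^sub>m = d\<^sub>m(a, b)\<close> as defined by this recurrence and the initial values \<open>1\<close> and
  \<open>1 + a + b\<close>, with arbitrary \<open>a\<close> and \<open>b\<close>.
  The series \<open>C(x; a, b)\<close> whose coefficient of \<open>x\<^sup>m\<close> is \<open>d\<^sub>m(a, b) / ((1 - p)(1 - p^2) \<dots> (1 - p^m))\<close>
  then satisfies \<open>(1 - x) C(x; a, b) = (1 + a x)(1 + b x) C(p x; a, b)\<close>. It is therefore the product of
  the factors \<open>(1 + a x p^k)(1 + b x p^k) / (1 - x p^k)\<close>, so that
  \<open>C(x; a, b) = (1 + a x)(1 + b x) C(x; a p, b p)\<close>. Comparing coefficients expresses
  \<open>d\<^sub>m(a, b)\<close> through three terms \<open>d\<^sub>j(a p, b p)\<close>; this finite identity, \<open>bressoud_shift\<close>, is proved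
  directly by induction, and no series are needed.

  Consecutive terms \<open>d\<^sub>j\<close> agree modulo high powers of \<open>p\<close>, hence
  \<open>d\<^sub>m(a, b)\<close> is congruent to \<open>(1 + a)(1 + b) d\<^sub>m(a p, b p)\<close> (\<open>bressoud_shift_dvd\<close>). Iterating this
  shows that \<open>d\<^sub>m\<close> is congruent, modulo a high power of \<open>p\<close>, to a product of factors
  \<open>(1 + a p^r)(1 + b p^r)\<close> (\<open>bressoud_limit\<close>). For the values of \<open>a\<close>, \<open>b\<close> and \<open>p\<close> above, this is
  the product of \<open>1 + q^k\<close> over the odd \<open>k\<close> below a bound growing with \<open>m\<close>, which generates the
  partitions into distinct odd parts below that bound. Taking \<open>m\<close> large gives the theorem.
\<close>

section \<open>A second-order recurrence\<close>

text \<open>The terms of the recurrence, over an arbitrary commutative ring; \<open>p\<close>, \<open>a\<close>, \<open>b\<close> are its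
  parameters and the last argument is the index.\<close>

fun bressoud :: "'a::comm_ring_1 \<Rightarrow> 'a \<Rightarrow> 'a \<Rightarrow> nat \<Rightarrow> 'a" where
  "bressoud p a b 0 = 1"
| "bressoud p a b (Suc 0) = 1 + a + b"
| "bressoud p a b (Suc (Suc m)) = (1 + (a + b) * p ^ Suc m) * bressoud p a b (Suc m)
     + a * b * p ^ m * (1 - p ^ Suc m) * bressoud p a b m"

text \<open>Replacing \<open>(a, b)\<close> by \<open>(a p, b p)\<close>. The identity is the comparison of coefficients of
  \<open>x^(m+2)\<close> in \<open>C(x; a, b) = (1 + a x)(1 + b x) C(x; a p, b p)\<close>, for the series \<open>C\<close> described at the
  beginning, multiplied by the common denominator.\<close>

lemma bressoud_shift:
  fixes p a b :: "'a::comm_ring_1"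
  defines "d \<equiv> bressoud p (a * p) (b * p)"
  shows "bressoud p a b (Suc (Suc m)) = d (Suc (Suc m)) + (a + b) * (1 - p ^ Suc (Suc m)) * d (Suc m)
     + a * b * (1 - p ^ Suc (Suc m)) * (1 - p ^ Suc m) * d m"
proof (induction m rule: induct_nat_012)
  case 0
  show ?case by (simp add: d_def algebra_simps)
next
  case 1
  show ?case by (simp add: d_def algebra_simps)
next
  case (ge2 m)
  \<comment> \<open>All terms are polynomials in \<open>p\<close>, \<open>P\<close>, \<open>a\<close>, \<open>b\<close> and the two lowest shifted terms
    \<open>x\<close>, \<open>y\<close>; after eliminating the others, the claim is a ring identity.\<close>
  define P where "P = p ^ m"
  define x y where "x = d m" and "y = d (Suc m)"
  define B2 B3 B4 where "B2 = bressoud p a b (Suc (Suc m))"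
    and "B3 = bressoud p a b (Suc (Suc (Suc m)))" and "B4 = bressoud p a b (Suc (Suc (Suc (Suc m))))"
  define d2 d3 d4 where "d2 = d (Suc (Suc m))" and "d3 = d (Suc (Suc (Suc m)))"
    and "d4 = d (Suc (Suc (Suc (Suc m))))"
  have e2: "d2 = (1 + (a + b) * p * p * P) * y + a * b * p * p * P * (1 - p * P) * x"
    by (simp add: d2_def d_def x_def y_def P_def algebra_simps)
  have e3: "d3 = (1 + (a + b) * p * p * p * P) * d2 + a * b * p * p * p * P * (1 - p * p * P) * y"
    by (simp only: d2_def d3_def d_def y_def P_def bressoud.simps(3)[of _ _ _ "Suc m"])
      (simp add: algebra_simps del: bressoud.simps)
  have e4: "d4 = (1 + (a + b) * p * p * p * p * P) * d3 + a * b * p * p * p * p * P * (1 - p * p * p * P) * d2"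
    by (simp only: d2_def d3_def d4_def d_def P_def bressoud.simps(3)[of _ _ _ "Suc (Suc m)"])
      (simp add: algebra_simps del: bressoud.simps)
  have f4: "B4 = (1 + (a + b) * p * p * p * P) * B3 + a * b * p * p * P * (1 - p * p * p * P) * B2"
    by (simp only: B2_def B3_def B4_def P_def bressoud.simps(3)[of _ _ _ "Suc (Suc m)"])
      (simp add: algebra_simps del: bressoud.simps)
  have f2: "B2 = d2 + (a + b) * (1 - p * p * P) * y + a * b * (1 - p * p * P) * (1 - p * P) * x"
    using ge2(1) by (simp add: B2_def d2_def x_def y_def P_def mult.assoc del: bressoud.simps)
  have f3: "B3 = d3 + (a + b) * (1 - p * p * p * P) * d2 + a * b * (1 - p * p * p * P) * (1 - p * p * P) * y"
    using ge2(2) by (simp add: B3_def d2_def d3_def y_def P_def mult.assoc del: bressoud.simps)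
  have "B4 = d4 + (a + b) * (1 - p * p * p * p * P) * d3
      + a * b * (1 - p * p * p * p * P) * (1 - p * p * p * P) * d2"
    unfolding f4 f2 f3 e4 e3 e2 by (simp add: algebra_simps)
  then show ?case
    by (simp add: B4_def d2_def d3_def d4_def P_def mult.assoc del: bressoud.simps)
qed

lemma bressoud_step_dvd:
  "p ^ m dvd bressoud p a b (Suc (Suc m)) - bressoud p a b (Suc m)"
proof -
  have "bressoud p a b (Suc (Suc m)) - bressoud p a b (Suc m)
    = p ^ m * ((a + b) * p * bressoud p a b (Suc m) + a * b * (1 - p ^ Suc m) * bressoud p a b m)"
    by (simp add: algebra_simps)
  then show ?thesis by simp
qed

lemma bressoud_shift_dvd:
  fixes p a b :: "'a::comm_ring_1"
  shows "p ^ m dvd bressoud p a b (m + 3) - (1 + a) * (1 + b) * bressoud p (a * p) (b * p) (m + 3)"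
proof -
  define d where "d = bressoud p (a * p) (b * p)"
  define d1 d2 d3 where "d1 = d (m + 1)" and "d2 = d (m + 2)" and "d3 = d (m + 3)"
  have 1: "p ^ m dvd d2 - d1"
    using bressoud_step_dvd[of p m] by (simp add: d1_def d2_def d_def)
  have "p ^ Suc m dvd d3 - d2"
    using bressoud_step_dvd[of p "Suc m"] by (simp add: d2_def d3_def d_def eval_nat_numeral)
  then have 2: "p ^ m dvd d3 - d2"
    by (rule power_le_dvd) simp
  have "bressoud p a b (m + 3) = d3 + (a + b) * (1 - p ^ m * p ^ 3) * d2
      + a * b * (1 - p ^ m * p ^ 3) * (1 - p ^ m * p ^ 2) * d1"
    using bressoud_shift[of p a b "Suc m"]
    by (simp add: d1_def d2_def d3_def d_def eval_nat_numeral mult_ac del: bressoud.simps)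
  then have "bressoud p a b (m + 3) - (1 + a) * (1 + b) * d3
      = p ^ m * (- (a + b) * p ^ 3 * d2 + a * b * (p ^ m * p ^ 5 - p ^ 3 - p ^ 2) * d1)
        - (a + b + a * b) * (d3 - d2) - a * b * (d2 - d1)"
    by (simp add: algebra_simps eval_nat_numeral)
  then show ?thesis
    using 1 2 by (simp add: d3_def d_def dvd_diff)
qed

lemma bressoud_cong_one:
  assumes "e dvd a" "e dvd b"
  shows "e dvd bressoud p a b m - 1"
proof (induction m rule: induct_nat_012)
  case 0
  show ?case by simp
next
  case 1
  show ?case using assms by simp
next
  case (ge2 m)
  have "bressoud p a b (Suc (Suc m)) - 1 = (bressoud p a b (Suc m) - 1)
     + (a * (p ^ Suc m * bressoud p a b (Suc m)) + b * (p ^ Suc m * bressoud p a b (Suc m)) 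
     + a * (b * p ^ m * (1 - p ^ Suc m) * bressoud p a b m))"
    by (simp add: algebra_simps)
  also have "e dvd \<dots>"
    using assms ge2(2) by (intro dvd_add dvd_mult2)
  finally show ?case .
qed

lemma bressoud_prod_dvd:
  fixes p a b :: "'a::comm_ring_1"
  shows "p ^ m dvd bressoud p a b (m + 3)
     - (\<Prod>r<R. (1 + a * p ^ r) * (1 + b * p ^ r)) * bressoud p (a * p ^ R) (b * p ^ R) (m + 3)"
proof (induction R)
  case 0
  show ?case by simp
next
  case (Suc R)
  define Q where "Q = (\<Prod>r<R. (1 + a * p ^ r) * (1 + b * p ^ r))"
  have "p ^ m dvd Q * (bressoud p (a * p ^ R) (b * p ^ R) (m + 3)
     - (1 + a * p ^ R) * (1 + b * p ^ R) * bressoud p (a * p ^ R * p) (b * p ^ R * p) (m + 3))"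
    by (intro dvd_mult bressoud_shift_dvd)
  from dvd_add[OF Suc this[unfolded Q_def]] show ?case
    by (simp add: algebra_simps del: bressoud.simps)
qed

text \<open>Taking \<open>R = m\<close> above, the remaining factor is 1 modulo \<open>p ^ m\<close>, since its two parameters are
  multiples of \<open>p ^ m\<close>.\<close>

lemma bressoud_limit:
  fixes p a b :: "'a::comm_ring_1"
  shows "p ^ m dvd bressoud p a b (m + 3) - (\<Prod>r<m. (1 + a * p ^ r) * (1 + b * p ^ r))"
proof -
  define Q where "Q = (\<Prod>r<m. (1 + a * p ^ r) * (1 + b * p ^ r))"
  have "p ^ m dvd Q * (bressoud p (a * p ^ m) (b * p ^ m) (m + 3) - 1)"
    by (intro dvd_mult bressoud_cong_one) simp_all
  from dvd_add[OF bressoud_prod_dvd[of p m a b m] this[unfolded Q_def]] show ?thesis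
    by (simp add: algebra_simps del: bressoud.simps)
qed

section \<open>Generating polynomials of sets of parts\<close>

text \<open>The generating polynomial of a finite family \<open>F\<close> of finite sets, where \<open>S\<close> has weight
  \<open>\<Sum>S\<close>. The variable \<open>q\<close> is an element of any commutative ring; it becomes the indeterminate of
  \<open>int poly\<close> when coefficients are read off.\<close>

definition set_gf :: "'a::comm_ring_1 \<Rightarrow> nat set set \<Rightarrow> 'a" where
  "set_gf q F = (\<Sum>S\<in>F. q ^ \<Sum>S)"

lemma coeff_set_gf:
  assumes "finite F"
  shows "poly.coeff (set_gf (monom (1::int) 1) F) n = int (card {S \<in> F. \<Sum>S = n})"
  using assms by (simp add: set_gf_def coeff_sum monom_power sum.If_cases Int_def)

lemma set_gf_insert:
  assumes "finite F" and "finite G" and "\<And>S. S \<in> F \<Longrightarrow> x \<notin> S" 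
    and G: "\<And>S. S \<in> G \<Longrightarrow> finite S \<and> x \<notin> S"
  shows "set_gf q (F \<union> insert x ` G) = set_gf q F + q ^ x * set_gf q G"
proof -
  have "inj_on (insert x) G"
    by (rule inj_onI) (metis G Diff_insert_absorb)
  moreover have "(\<Sum>S\<in>G. q ^ \<Sum>(insert x S)) = (\<Sum>S\<in>G. q ^ x * q ^ \<Sum>S)"
    using G by (intro sum.cong) (auto simp: power_add)
  moreover have "F \<inter> insert x ` G = {}"
    using assms by blast
  ultimately show ?thesis
    using assms by (simp add: set_gf_def sum.union_disjoint sum.reindex sum_distrib_left)
qed

lemma set_gf_Pow:
  assumes "finite A"
  shows "set_gf q (Pow A) = (\<Prod>x\<in>A. 1 + q ^ x)"
  using assms
proof (induction A)
  case empty
  show ?case by (simp add: set_gf_def)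
next
  case (insert x A)
  have "set_gf q (Pow (insert x A)) = set_gf q (Pow A) + q ^ x * set_gf q (Pow A)"
    unfolding Pow_insert
    by (rule set_gf_insert) (use insert in \<open>auto intro: finite_subset\<close>)
  then show ?case
    using insert by (simp add: algebra_simps)
qed

lemma prod_odd_below:
  "(\<Prod>x | odd x \<and> x < 4 * m. 1 + q ^ x) 
    = (\<Prod>r<m. (1 + q * (q ^ 4) ^ r) * (1 + q ^ 3 * (q ^ 4) ^ r :: 'a::comm_ring_1))"
proof (induction m)
  case 0
  show ?case by simp
next
  case (Suc m)
  have "{x. odd x \<and> x < 4 * Suc m} = insert (4 * m + 1) (insert (4 * m + 3) {x. odd x \<and> x < 4 * m})"
    by auto presburger
  then show ?case
    using Suc by (simp add: power_add mult_ac flip: power_mult)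
qed

section \<open>Sets with gaps\<close>

text \<open>The gap conditions on a partition with distinct parts, expressed on its set of parts. Since
  differences of at least 4 between neighbours add up, the condition on consecutive parts is imposed on
  all pairs.\<close>

definition gap_set :: "nat set \<Rightarrow> bool" where
  "gap_set S \<longleftrightarrow> (\<forall>x\<in>S. odd x \<or> 4 dvd x) \<and> (\<forall>x\<in>S. \<forall>y\<in>S. x < y \<longrightarrow> x + 4 \<le> y) \<and>
     (\<forall>x\<in>S. \<forall>y\<in>S. x < y \<and> 4 dvd x \<and> 4 dvd y \<longrightarrow> x + 8 \<le> y)"

text \<open>The gap sets with parts from 1 to \<open>N\<close>.\<close>

definition gap_sets :: "nat \<Rightarrow> nat set set" where
  "gap_sets N = {S. S \<subseteq> {1..N} \<and> gap_set S}"

lemma finite_gap_sets: "finite (gap_sets N)"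
  by (rule finite_subset[of _ "Pow {1..N}"]) (auto simp: gap_sets_def)

lemma gap_set_subset: "gap_set S \<Longrightarrow> T \<subseteq> S \<Longrightarrow> gap_set T"
  unfolding gap_set_def by blast

text \<open>Splitting off the largest part \<open>N\<close>, when it can be added exactly to those gap sets whose parts
  are at most \<open>M\<close>.\<close>

lemma set_gf_gap_sets_insert:
  assumes "N > 0" and G: "\<And>S. S \<subseteq> {1..<N} \<Longrightarrow> gap_set S \<Longrightarrow> gap_set (insert N S) \<longleftrightarrow> S \<subseteq> {1..M}"
    and "M < N"
  shows "set_gf q (gap_sets N) = set_gf q (gap_sets (N - 1)) + q ^ N * set_gf q (gap_sets M)"
proof -
  have top: "{1..N} = insert N {1..N - 1}"
    using \<open>N > 0\<close> by auto
  have "gap_sets N = gap_sets (N - 1) \<union> insert N ` gap_sets M"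
  proof (intro equalityI subsetI)
    fix S assume S: "S \<in> gap_sets N"
    show "S \<in> gap_sets (N - 1) \<union> insert N ` gap_sets M"
    proof (cases "N \<in> S")
      case True
      have "gap_set (insert N (S - {N}))" "gap_set (S - {N})" "S - {N} \<subseteq> {1..<N}"
        using S True by (auto simp: gap_sets_def insert_absorb intro: gap_set_subset)
      then have "S - {N} \<subseteq> {1..M}"
        using G[of "S - {N}"] by simp
      then have "S - {N} \<in> gap_sets M"
        using \<open>gap_set (S - {N})\<close> by (simp add: gap_sets_def)
      then have "insert N (S - {N}) \<in> insert N ` gap_sets M"
        by (rule imageI)
      then show ?thesis
        using True by (simp add: insert_absorb)
    next
      case False
      then show ?thesis
        using S by (simp add: gap_sets_def top subset_insert del: One_nat_def)
    qed
  next
    fix S assume "S \<in> gap_sets (N - 1) \<union> insert N ` gap_sets M"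
    then show "S \<in> gap_sets N"
    proof
      assume "S \<in> gap_sets (N - 1)"
      then show ?thesis by (simp add: gap_sets_def top subset_insertI2 del: One_nat_def)
    next
      assume "S \<in> insert N ` gap_sets M"
      then obtain T where T: "S = insert N T" "T \<subseteq> {1..M}" "gap_set T"
        by (auto simp: gap_sets_def)
      moreover have "T \<subseteq> {1..<N}"
        using T \<open>M < N\<close> by auto
      ultimately show ?thesis
        using G[of T] \<open>N > 0\<close> by (auto simp: gap_sets_def)
    qed
  qed
  moreover have "set_gf q (gap_sets (N - 1) \<union> insert N ` gap_sets M)
      = set_gf q (gap_sets (N - 1)) + q ^ N * set_gf q (gap_sets M)"
  proof (rule set_gf_insert)
    fix S assume "S \<in> gap_sets M"
    then have "S \<subseteq> {1..M}" by (simp add: gap_sets_def)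
    then show "finite S \<and> N \<notin> S"
      using \<open>M < N\<close> by (auto intro: finite_subset[OF _ finite_atLeastAtMost])
  qed (use \<open>N > 0\<close> in \<open>auto simp: finite_gap_sets gap_sets_def\<close>)
  ultimately show ?thesis by simp
qed

lemma gap_gf_odd:
  assumes "odd N"
  shows "set_gf q (gap_sets N) = set_gf q (gap_sets (N - 1)) + q ^ N * set_gf q (gap_sets (N - 4))"
proof (rule set_gf_gap_sets_insert)
  show N: "N > 0" using assms by (rule odd_pos)
  then show "N - 4 < N" by simp
  fix S assume S: "S \<subseteq> {1..<N}" "gap_set S"
  show "gap_set (insert N S) \<longleftrightarrow> S \<subseteq> {1..N - 4}"
  proof
    assume "gap_set (insert N S)"
    then have "\<forall>x\<in>S. x < N \<longrightarrow> x + 4 \<le> N" by (simp add: gap_set_def)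
    then show "S \<subseteq> {1..N - 4}" using S by force
  next
    assume "S \<subseteq> {1..N - 4}"
    then have "\<forall>x\<in>S. x + 4 \<le> N" by force
    moreover have "\<not> 4 dvd N" using assms by presburger
    ultimately show "gap_set (insert N S)"
      using S assms by (auto simp: gap_set_def)
  qed
qed

text \<open>If \<open>N\<close> is a multiple of 4, the next part is at most \<open>N - 4\<close>, and \<open>N - 4\<close> itself is
  excluded as a multiple of 4 too close to \<open>N\<close>. All smaller multiples of 4 are far enough away, so the
  bound for the next part is \<open>N - 5\<close>.\<close>

lemma gap_gf_dvd4:
  assumes "4 dvd N" "N > 0"
  shows "set_gf q (gap_sets N) = set_gf q (gap_sets (N - 1)) + q ^ N * set_gf q (gap_sets (N - 5))"
proof (rule set_gf_gap_sets_insert)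
  show "N > 0" "N - 5 < N" using assms by simp_all
  fix S assume S: "S \<subseteq> {1..<N}" "gap_set S"
  show "gap_set (insert N S) \<longleftrightarrow> S \<subseteq> {1..N - 5}"
  proof
    assume "gap_set (insert N S)"
    then have *: "\<forall>x\<in>S. x < N \<longrightarrow> x + 4 \<le> N \<and> (4 dvd x \<longrightarrow> x + 8 \<le> N)"
      using \<open>4 dvd N\<close> by (simp add: gap_set_def)
    show "S \<subseteq> {1..N - 5}"
    proof
      fix x assume "x \<in> S"
      then have x: "1 \<le> x" "x + 4 \<le> N" "4 dvd x \<longrightarrow> x + 8 \<le> N" 
        using S * by auto
      then have "x + 4 \<noteq> N" using \<open>4 dvd N\<close> by auto
      then show "x \<in> {1..N - 5}" using x by simp
    qed
  next
    assume S': "S \<subseteq> {1..N - 5}"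
    have "x + 4 \<le> N \<and> x < N \<and> (4 dvd x \<longrightarrow> x + 8 \<le> N)" if "x \<in> S" for x
    proof -
      have "x + 5 \<le> N" using that S' by force
      moreover have "x + 8 \<le> N" if "4 dvd x" 
        using that \<open>4 dvd N\<close> \<open>x + 5 \<le> N\<close> by presburger
      ultimately show ?thesis by simp
    qed
    then show "gap_set (insert N S)"
      using S assms by (fastforce simp: gap_set_def)
  qed
qed

lemma gap_sets_2_mod_4: "gap_sets (4 * m + 2) = gap_sets (4 * m + 1)"
proof -
  have "x \<le> 4 * m + 1" if "S \<in> gap_sets (4 * m + 2)" "x \<in> S" for S x
  proof -
    have "x \<le> 4 * m + 2" "odd x \<or> 4 dvd x" 
      using that by (auto simp: gap_sets_def gap_set_def)
    then show ?thesis by presburger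
  qed
  then show ?thesis by (fastforce simp: gap_sets_def)
qed

text \<open>For \<open>m = 0\<close> the truncated bound \<open>4 * m - 1\<close> is 0, which leaves only the empty set, as the
  initial value 1 requires.\<close>

lemma gap_gf_bressoud:
  "set_gf q (gap_sets (4 * m - 1)) = bressoud (q ^ 4) q (q ^ 3) m"
proof (induction m rule: induct_nat_012)
  define g where "g N = set_gf q (gap_sets N)" for N
  have g3: "g (4 * m + 3) = g (4 * m + 1) + q ^ (4 * m + 3) * g (4 * m - 1)" for m
    using gap_gf_odd[of "4 * m + 3" q] gap_sets_2_mod_4[of m] by (simp add: g_def)
  have g1: "g (4 * m + 1) = g (4 * m) + q ^ (4 * m + 1) * g (4 * m - 3)" for m
    using gap_gf_odd[of "4 * m + 1" q] by (simp add: g_def)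
  have g0: "g (4 * m + 4) = g (4 * m + 3) + q ^ (4 * m + 4) * g (4 * m - 1)" for m
    using gap_gf_dvd4[of "4 * m + 4" q] by (simp add: g_def add.commute)
  have "gap_sets 0 = {{}}" by (auto simp: gap_sets_def gap_set_def)
  then have g_0: "g 0 = 1" by (simp add: g_def set_gf_def)
  {
    case 0
    show ?case using g_0 by (simp add: g_def)
  next
    case 1
    show ?case using g3[of 0] g1[of 0] g_0 by (simp add: g_def)
  next
    case (ge2 m)
    define P where "P = q ^ (4 * m)"
    have pw: "q ^ (4 * m + k) = q ^ k * P" "q ^ (k + 4 * m) = q ^ k * P" for k
      by (simp_all add: P_def power_add)
    have h7: "g (4 * m + 7) = g (4 * m + 5) + q ^ 7 * P * g (4 * m + 3)"
      using g3[of "Suc m"] by (simp add: pw add.commute)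
    have h5: "g (4 * m + 5) = g (4 * m + 4) + q ^ 5 * P * g (4 * m + 1)"
      using g1[of "Suc m"] by (simp add: pw add.commute)
    have h4: "g (4 * m + 4) = g (4 * m + 3) + q ^ 4 * P * g (4 * m - 1)"
      using g0[of m] by (simp add: pw)
    have h1: "g (4 * m + 1) = g (4 * m + 3) - q ^ 3 * P * g (4 * m - 1)"
      using g3[of m] by (simp add: pw)
    \<comment> \<open>Substituting \<open>h1\<close> eliminates the bound \<open>4 * m + 1\<close>.\<close>
    have "g (4 * m + 7) = (1 + (q + q ^ 3) * (q ^ 4 * P)) * g (4 * m + 3)
      + q * q ^ 3 * P * (1 - q ^ 4 * P) * g (4 * m - 1)"
      unfolding h7 h5 h4 h1 by (simp add: algebra_simps power_numeral_reduce)
    then show ?case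
      using ge2 by (simp add: g_def P_def power_mult add.commute)
  }
qed

section \<open>Partitions as sets of parts\<close>

lemma card_distinct_partitions:
  "card {xs. is_partition n xs \<and> distinct xs \<and> P (set xs)}
    = card {S. S \<subseteq> {1..n} \<and> P S \<and> \<Sum>S = n}"
proof (rule bij_betw_same_card[of set], rule bij_betwI[of _ _ _ "\<lambda>S. rev (sorted_list_of_set S)"])
  show "set \<in> {xs. is_partition n xs \<and> distinct xs \<and> P (set xs)} \<rightarrow> {S. S \<subseteq> {1..n} \<and> P S \<and> \<Sum>S = n}"
    by (auto simp: is_partition_def member_le_sum_list Suc_le_eq simp flip: distinct_sum_list_conv_Sum)
  show "(\<lambda>S. rev (sorted_list_of_set S)) \<in> {S. S \<subseteq> {1..n} \<and> P S \<and> \<Sum>S = n} \<rightarrow>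
      {xs. is_partition n xs \<and> distinct xs \<and> P (set xs)}"
  proof
    fix S assume "S \<in> {S. S \<subseteq> {1..n} \<and> P S \<and> \<Sum>S = n}"
    then have S: "S \<subseteq> {1..n}" "P S" "\<Sum>S = n" and "finite S"
      by (auto intro: finite_subset[OF _ finite_atLeastAtMost])
    then show "rev (sorted_list_of_set S) \<in> {xs. is_partition n xs \<and> distinct xs \<and> P (set xs)}"
      by (auto simp: is_partition_def sorted_wrt_rev sum_list_rev 
          distinct_sum_list_conv_Sum Suc_le_eq)
  qed
next
  fix xs assume "xs \<in> {xs. is_partition n xs \<and> distinct xs \<and> P (set xs)}"
  then have "sorted (rev xs)" "distinct (rev xs)"
    by (auto simp: is_partition_def sorted_wrt_rev)
  then show "rev (sorted_list_of_set (set xs)) = xs"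
    using sorted_list_of_set.idem_if_sorted_distinct[of "rev xs"] by simp
next
  fix S assume "S \<in> {S. S \<subseteq> {1..n} \<and> P S \<and> \<Sum>S = n}"
  then have "finite S"
    by (auto intro: finite_subset[OF _ finite_atLeastAtMost])
  then show "set (rev (sorted_list_of_set S)) = S"
    by simp
qed

lemma gap_list_iff_gap_set:
  assumes "sorted_wrt (\<ge>) xs" "distinct xs"
  shows "(\<forall>x\<in>set xs. odd x \<or> 4 dvd x) \<and>
     (\<forall>i. Suc i < length xs \<longrightarrow> xs ! Suc i + 4 \<le> xs ! i) \<and>
     (\<forall>i j. i < j \<and> j < length xs \<and> 4 dvd xs ! i \<and> 4 dvd xs ! j \<longrightarrow> xs ! j + 8 \<le> xs ! i)
     \<longleftrightarrow> gap_set (set xs)"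
proof -
  have lt: "xs ! j < xs ! i \<longleftrightarrow> i < j" if "i < length xs" "j < length xs" for i j
  proof -
    have "xs ! v < xs ! u" if "u < v" "v < length xs" for u v
      using that assms sorted_wrt_nth_less[of "(\<ge>)" xs u v] nth_eq_iff_index_eq[of xs u v] by force
    then show ?thesis
      using that by (metis less_asym less_irrefl linorder_neqE_nat)
  qed
  have pairs: "(\<forall>i j. i < j \<longrightarrow> j < length xs \<longrightarrow> Q (xs ! j) (xs ! i))
      \<longleftrightarrow> (\<forall>x\<in>set xs. \<forall>y\<in>set xs. x < y \<longrightarrow> Q x y)" (is "?L \<longleftrightarrow> ?R") for Q
  proof
    assume L: ?L
    show ?R
    proof (intro ballI impI)
      fix x y assume "x \<in> set xs" "y \<in> set xs" "x < y"
      then obtain i j where "x = xs ! j" "y = xs ! i" "i < length xs" "j < length xs"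
        by (metis in_set_conv_nth)
      then show "Q x y" using L lt \<open>x < y\<close> by blast
    qed
  next
    assume R: ?R
    show ?L
    proof (intro allI impI)
      fix i j assume "i < j" "j < length xs"
      moreover from this have "i < length xs" by simp
      ultimately show "Q (xs ! j) (xs ! i)" using R lt nth_mem by blast
    qed
  qed
  have "transp (\<lambda>x y :: nat. y + 4 \<le> x)"
    by (rule transpI) simp
  then have "(\<forall>i. Suc i < length xs \<longrightarrow> xs ! Suc i + 4 \<le> xs ! i)
      \<longleftrightarrow> (\<forall>i j. i < j \<longrightarrow> j < length xs \<longrightarrow> xs ! j + 4 \<le> xs ! i)"
    using successively_conv_sorted_wrt[of "\<lambda>x y. y + 4 \<le> x" xs]
    by (simp add: successively_conv_nth sorted_wrt_iff_nth_less)
  also have "\<dots> \<longleftrightarrow> (\<forall>x\<in>set xs. \<forall>y\<in>set xs. x < y \<longrightarrow> x + 4 \<le> y)"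
    by (rule pairs)
  finally have 1: "(\<forall>i. Suc i < length xs \<longrightarrow> xs ! Suc i + 4 \<le> xs ! i)
      \<longleftrightarrow> (\<forall>x\<in>set xs. \<forall>y\<in>set xs. x < y \<longrightarrow> x + 4 \<le> y)" .
  have 2: "(\<forall>i j. i < j \<and> j < length xs \<and> 4 dvd xs ! i \<and> 4 dvd xs ! j \<longrightarrow> xs ! j + 8 \<le> xs ! i)
      \<longleftrightarrow> (\<forall>x\<in>set xs. \<forall>y\<in>set xs. x < y \<and> 4 dvd x \<and> 4 dvd y \<longrightarrow> x + 8 \<le> y)"
    using pairs[of "\<lambda>x y. 4 dvd x \<and> 4 dvd y \<longrightarrow> x + 8 \<le> y"] by (simp only: imp_conjL) blast
  show ?thesis
    unfolding gap_set_def 1 2 by blast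
qed

lemma card_distinct_odd_partitions:
  "card (distinct_odd_partitions n) = card {S. S \<subseteq> {1..n} \<and> (\<forall>x\<in>S. odd x) \<and> \<Sum>S = n}"
  unfolding distinct_odd_partitions_def by (rule card_distinct_partitions)

lemma card_gap_partitions:
  "card (gap_partitions n) = card {S. S \<subseteq> {1..n} \<and> gap_set S \<and> \<Sum>S = n}"
proof -
  have "gap_partitions n = {xs. is_partition n xs \<and> distinct xs \<and> gap_set (set xs)}"
    unfolding gap_partitions_def
    by (intro Collect_cong conj_cong refl gap_list_iff_gap_set) (simp_all add: is_partition_def)
  then show ?thesis
    by (simp add: card_distinct_partitions)
qed

text \<open>Once the sum is fixed to \<open>n\<close>, any other bound on the parts may be replaced by \<open>n\<close>.\<close>

lemma subset_of_sum:
  fixes S :: "nat set"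
  assumes "S \<subseteq> {1..N}" "\<Sum>S = n"
  shows "S \<subseteq> {1..n}"
proof
  fix x assume "x \<in> S"
  moreover have "finite S" using assms by (auto intro: finite_subset[OF _ finite_atLeastAtMost])
  ultimately show "x \<in> {1..n}"
    using assms member_le_sum[of x S "\<lambda>x. x"] by auto
qed

theorem theorem1p3:
  fixes n :: nat
  assumes "n > 0"
  shows "card (distinct_odd_partitions n) = card (gap_partitions n)"
proof -
  \<comment> \<open>The congruence modulo \<open>X ^ (4 * n)\<close> determines the coefficient of \<open>X ^ n\<close>, as \<open>n < 4 * n\<close>; the
    index \<open>n + 3\<close> in \<open>G\<close> is the one for which \<open>bressoud_limit\<close> gives this modulus.\<close>
  define X where "X = monom (1::int) 1"
  define D where "D = Pow {x. odd x \<and> x < 4 * n}"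
  define G where "G = gap_sets (4 * (n + 3) - 1)"
  have "(X ^ 4) ^ n dvd set_gf X G - set_gf X D"
    unfolding G_def D_def gap_gf_bressoud
    using bressoud_limit[of "X ^ 4" n X "X ^ 3"] by (simp add: set_gf_Pow prod_odd_below)
  then obtain h where "set_gf X G - set_gf X D = monom 1 (4 * n) * h"
    by (auto simp: X_def monom_power)
  then have "poly.coeff (set_gf X G - set_gf X D) n = 0"
    using assms by (simp add: coeff_monom_mult)
  moreover have "finite D" "finite G"
    by (simp_all add: D_def G_def finite_gap_sets)
  ultimately have "card {S \<in> G. \<Sum>S = n} = card {S \<in> D. \<Sum>S = n}"
    by (simp add: X_def coeff_set_gf del: One_nat_def)
  moreover have "{S \<in> G. \<Sum>S = n} = {S. S \<subseteq> {1..n} \<and> gap_set S \<and> \<Sum>S = n}"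
  proof -
    have "S \<subseteq> {1..n}" if "S \<in> G" "\<Sum>S = n" for S
    proof -
      have "S \<subseteq> {1..4 * (n + 3) - 1}"
        using \<open>S \<in> G\<close> unfolding G_def gap_sets_def by blast
      then show ?thesis using \<open>\<Sum>S = n\<close> by (rule subset_of_sum)
    qed
    moreover have "S \<in> G" if "S \<subseteq> {1..n}" "gap_set S" for S
    proof -
      have "{1..n} \<subseteq> {1..4 * (n + 3) - 1}" by auto
      then show ?thesis using that unfolding G_def gap_sets_def by blast
    qed
    moreover have "gap_set S" if "S \<in> G" for S
      using that unfolding G_def gap_sets_def by blast
    ultimately show ?thesis by blast
  qed
  moreover have "{S \<in> D. \<Sum>S = n} = {S. S \<subseteq> {1..n} \<and> (\<forall>x\<in>S. odd x) \<and> \<Sum>S = n}"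
  proof -
    have "S \<subseteq> {1..n}" if "S \<in> D" "\<Sum>S = n" for S
    proof -
      have "S \<subseteq> {1..4 * n}"
      proof
        fix x assume "x \<in> S"
        then have "odd x" "x < 4 * n"
          using \<open>S \<in> D\<close> unfolding D_def by blast+
        then show "x \<in> {1..4 * n}"
          by (simp add: odd_pos Suc_le_eq)
      qed
      then show ?thesis using \<open>\<Sum>S = n\<close> by (rule subset_of_sum)
    qed
    moreover have "S \<in> D" if "S \<subseteq> {1..n}" "\<forall>x\<in>S. odd x" for S
    proof -
      have "{1..n} \<subseteq> {..<4 * n}" using assms by auto
      then show ?thesis using that unfolding D_def by blast
    qed
    moreover have "\<forall>x\<in>S. odd x" if "S \<in> D" for S
      using that unfolding D_def by blast
    ultimately show ?thesis by blast
  qed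
  ultimately show ?thesis
    by (simp add: card_distinct_odd_partitions card_gap_partitions)
qed

end
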